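(* Suppose that $\mathbf{c}=(c_n)_{n=1}^\infty$ is a sequence of positive real numbers satisfying $$\sum_{j=n+1}^\infty c_j<2^{-n}c_n\quad\text{for every } n\in\mathbb{N}.$$ Then every unbounded, infinite discrete set $\Lambda\subset[0,\infty)$ is $\mathbf{c}$-type $2$.
   Context: $\mathbb{N}=\{1,2,\dots\}$. "Discrete" means that $\Lambda$ has only finitely many elements in each bounded interval; write $\Lambda=\{\lambda_1,\lambda_2,\dots\}$ with $\lambda_1<\lambda_2<\dots$ and $\lambda_n\to\infty$. For a sequence $\mathbf{c}=(c_n)_{n=1}^\infty$ of positive real numbers, $\Lambda$ is called $\mathbf{c}$-type $2$ if there exists a measurable function $f:\mathbb{R}\to[0,+\infty)$ such that the series $s_{\mathbf{c},f}(x)=\sum_{n=1}^\infty c_n f(x+\lambda_n)$ does not converge for Lebesgue almost every $x\in\mathbb{R}$ and does not diverge for Lebesgue almost every $x\in\mathbb{R}$ either; equivalently, both $\{x: s_{\mathbf{c},f}(x)<\infty\}$ and $\{x: s_{\mathbf{c},f}(x)=\infty\}$ have positive Lebesgue measure. *)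

theory Defs
  imports "HOL-Analysis.Analysis"
begin

text \<open>
  Sequences are indexed by the positive integers; for a function on \<^typ>\<open>nat\<close> that represents
  such a sequence, the value at \<open>0\<close> is irrelevant.
\<close>

text \<open>
  This is stronger than the library predicate \<^const>\<open>discrete\<close>, which only requires every
  point of the set to be isolated.
\<close>

definition interval_discrete :: "real set \<Rightarrow> bool" where
  "interval_discrete \<Lambda> \<longleftrightarrow> (\<forall>a b. finite (\<Lambda> \<inter> {a..b}))"

definition increasing_enumeration :: "(nat \<Rightarrow> real) \<Rightarrow> real set \<Rightarrow> bool" where
  "increasing_enumeration l \<Lambda> \<longleftrightarrow> strict_mono_on {1..} l \<and> l ` {1..} = \<Lambda>"

text \<open>
  The enumeration of \<open>\<Lambda>\<close> is unique on the positive integers if it exists, and it exists for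
  every infinite discrete \<open>\<Lambda> \<subseteq> [0, \<infinity>)\<close>. Since the series has nonnegative terms, failure of
  summability is divergence to infinity.
\<close>

definition c_type_2 :: "(nat \<Rightarrow> real) \<Rightarrow> real set \<Rightarrow> bool" where
  "c_type_2 c \<Lambda> \<longleftrightarrow>
    (\<exists>l. increasing_enumeration l \<Lambda> \<and>
      (\<exists>f :: real \<Rightarrow> real. f \<in> borel_measurable lebesgue \<and> (\<forall>x. 0 \<le> f x) \<and>
        \<not> (AE x in lebesgue. summable (\<lambda>n. c (Suc n) * f (x + l (Suc n)))) \<and>
        \<not> (AE x in lebesgue. \<not> summable (\<lambda>n. c (Suc n) * f (x + l (Suc n))))))"

end

(* Let f be the step function equal to 1/c_m on [lambda_m, lambda_{m+1}). If x >= 0, then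
   f(x + lambda_n) >= 1/c_n, so no term of the series is below 1. If x < 0, then f(x + lambda_n)
   is 0 or 1/c_m for some m < n, so the n-th term is at most c_n / c_{n-1} < 2^{-(n-1)}. *)
theory Submission
  imports Defs
begin

text \<open>For \<open>x < y\<close> in \<open>A\<close>, the element \<open>y\<close> lies in the
  second segment but not in the first. Ranks thus embed \<open>A\<close> into the naturals.\<close>

lemma strict_mono_on_card_below:
  fixes A :: "'a :: linorder set"
  assumes "\<And>x. finite (A \<inter> {..x})"
  shows "strict_mono_on A (\<lambda>x. card (A \<inter> {..x}))"
proof (rule strict_mono_onI)
  fix x y assume "x \<in> A" "y \<in> A" "x < y"
  then have "A \<inter> {..x} \<subset> A \<inter> {..y}"
    by (auto simp: psubset_eq set_eq_iff) (metis leD order_refl)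
  then show "card (A \<inter> {..x}) < card (A \<inter> {..y})"
    by (simp add: assms psubset_card_mono)
qed

text \<open>The ranks form an infinite set of naturals, which \<open>enumerate\<close> lists in
  increasing order; inverting the rank map carries this list back to \<open>A\<close>.\<close>

lemma ex_strict_mono_enumeration:
  fixes A :: "'a :: linorder set"
  assumes fin: "\<And>x. finite (A \<inter> {..x})" and inf: "infinite A"
  obtains h :: "nat \<Rightarrow> 'a" where "strict_mono h" "range h = A"
proof -
  define g where "g = (\<lambda>x. card (A \<inter> {..x}))"
  have g: "strict_mono_on A g"
    unfolding g_def by (rule strict_mono_on_card_below[OF fin])
  have inj: "inj_on g A"
    using g by (rule strict_mono_on_imp_inj_on)
  have inf': "infinite (g ` A)"
    using inf inj finite_imageD by blast
  define h where "h = (\<lambda>n. inv_into A g (enumerate (g ` A) n))"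
  have mem: "h n \<in> A" and gh: "g (h n) = enumerate (g ` A) n" for n
    using enumerate_in_set[OF inf', of n] unfolding h_def
    by (auto intro: inv_into_into f_inv_into_f)
  have "strict_mono h"
  proof (rule strict_monoI)
    fix m n :: nat assume "m < n"
    then have "g (h m) < g (h n)"
      using inf' by (simp add: gh)
    then show "h m < h n"
      by (simp add: mem strict_mono_on_less[OF g])
  qed
  moreover have "range h = A"
  proof
    show "A \<subseteq> range h"
    proof
      fix x assume x: "x \<in> A"
      then obtain n where "enumerate (g ` A) n = g x"
        using enumerate_Ex[OF inf', of "g x"] by blast
      then have "h n = x"
        unfolding h_def using inj x by simp
      then show "x \<in> range h" by blast
    qed
  qed (use mem in blast)
  ultimately show thesis by (rule that)
qed

text \<open>A nondegenerate interval has positive measure. This serves with \<open>P\<close> as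
  convergence and again with \<open>P\<close> as divergence.\<close>

lemma not_AE_lebesgue_if_fails_on_Icc:
  fixes a b :: real
  assumes "a < b" and "\<And>x. x \<in> {a..b} \<Longrightarrow> \<not> P x"
  shows "\<not> (AE x in lebesgue. P x)"
proof
  assume "AE x in lebesgue. P x"
  then have "AE x in lebesgue. x \<notin> {a..b}"
    by (rule AE_mp) (use assms in auto)
  then have "emeasure lebesgue {a..b} = 0"
    by (subst (asm) AE_iff_measurable[where N = "{a..b}"]) auto
  then show False
    using assms(1) by simp
qed

text \<open>Indices start at 0 here: \<open>c n\<close> and \<open>l n\<close> stand for the terms
  numbered \<open>n + 1\<close> in the theorem. \<open>fin\<close> makes the maximum defining
  \<open>f\<close> range over a finite set.\<close>

lemma step_function_c_type_2:
  fixes c l :: "nat \<Rightarrow> real"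
  assumes pos: "\<And>n. 0 < c n"
    and decay: "\<And>n. c (Suc n) \<le> c n / 2 ^ n"
    and l: "strict_mono l" and fin: "\<And>y. finite {m. l m \<le> y}"
  obtains f :: "real \<Rightarrow> real" where "mono f" "\<And>x. 0 \<le> f x"
    "\<And>x. 0 \<le> x \<Longrightarrow> \<not> summable (\<lambda>n. c n * f (x + l n))"
    "\<And>x. x < 0 \<Longrightarrow> summable (\<lambda>n. c n * f (x + l n))"
proof -
  \<comment> \<open>As \<open>c\<close> decreases, the maximum is attained at the last
    \<open>m\<close> with \<open>l m \<le> y\<close>. The inserted 0 is the value to the left of
    \<open>l 0\<close>. Written as a maximum over a set growing with \<open>y\<close>,
    \<open>f\<close> is visibly monotone.\<close>
  define f where "f y = Max (insert 0 ((\<lambda>m. 1 / c m) ` {m. l m \<le> y}))" for y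
  have "decseq c"
  proof (rule decseq_SucI)
    fix n
    have "c n / 2 ^ n \<le> c n / 1"
      using pos[of n] by (intro divide_left_mono) auto
    with decay[of n] show "c (Suc n) \<le> c n" by simp
  qed
  have nonneg: "0 \<le> f x" for x
    unfolding f_def using fin by (intro Max_ge) auto
  have "mono f"
    unfolding f_def using fin by (intro monoI Max_mono) auto
  moreover have "\<not> summable (\<lambda>n. c n * f (x + l n))" if "0 \<le> x" for x
  proof
    assume "summable (\<lambda>n. c n * f (x + l n))"
    then have "(\<lambda>n. c n * f (x + l n)) \<longlonglongrightarrow> 0"
      by (rule summable_LIMSEQ_zero)
    moreover have "1 \<le> c n * f (x + l n)" for n
    proof -
      have "1 / c n \<le> f (x + l n)"
        unfolding f_def using fin that by (intro Max_ge) auto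
      then show ?thesis
        using pos[of n] by (simp add: field_simps)
    qed
    ultimately have "1 \<le> (0::real)"
      by (intro LIMSEQ_le_const) auto
    then show False by simp
  qed
  moreover have "summable (\<lambda>n. c n * f (x + l n))" if "x < 0" for x
  proof -
    \<comment> \<open>The geometric bound compares each term with the preceding coefficient, so it
      starts at index 1; the single term at 0 does not affect summability.\<close>
    have "c (Suc n) * f (x + l (Suc n)) \<le> (1 / 2) ^ n" for n
    proof -
      have "f (x + l (Suc n)) \<le> 1 / c n"
        unfolding f_def
      proof (rule Max.boundedI)
        fix a assume "a \<in> insert 0 ((\<lambda>m. 1 / c m) ` {m. l m \<le> x + l (Suc n)})"
        then consider "a = 0" | m where "a = 1 / c m" "l m \<le> x + l (Suc n)" by auto
        then show "a \<le> 1 / c n"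
        proof cases
          case 1
          then show ?thesis using pos[of n] by simp
        next
          case 2
          then have "l m < l (Suc n)" using \<open>x < 0\<close> by simp
          then have "m \<le> n" using l by (simp add: strict_mono_less)
          then have "c n \<le> c m" using \<open>decseq c\<close> by (simp add: decseqD)
          then show ?thesis using 2 pos[of n] by (simp add: frac_le)
        qed
      qed (use fin in auto)
      then have "c (Suc n) * f (x + l (Suc n)) \<le> c n / 2 ^ n * (1 / c n)"
        using pos[of n] by (intro mult_mono decay nonneg) auto
      then show ?thesis
        using pos[of n] by (simp add: field_simps)
    qed
    then have "summable (\<lambda>n. c (Suc n) * f (x + l (Suc n)))"
      using pos nonneg
      by (intro summable_comparison_test'[OF summable_geometric[of "1 / 2 :: real"], of 0])
        (auto simp: abs_mult less_imp_le)
    then show ?thesis by (subst (asm) summable_Suc_iff)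
  qed
  ultimately show thesis
    using nonneg by (intro that[of f]) auto
qed

theorem theorem5p2:
  fixes c :: "nat \<Rightarrow> real" and \<Lambda> :: "real set"
  assumes "\<And>n. n \<ge> 1 \<Longrightarrow> 0 < c n"
    and "\<And>n. n \<ge> 1 \<Longrightarrow> summable (\<lambda>j. c (n + 1 + j)) \<and> (\<Sum>j. c (n + 1 + j)) < c n / 2 ^ n"
    and "\<Lambda> \<subseteq> {0..}"
    and "interval_discrete \<Lambda>"
    and "infinite \<Lambda>"
    and "\<not> bounded \<Lambda>"
  shows "c_type_2 c \<Lambda>"
proof -
  have fin: "finite (\<Lambda> \<inter> {..x})" for x
  proof -
    have "\<Lambda> \<inter> {..x} = \<Lambda> \<inter> {0..x}" using assms(3) by auto
    then show ?thesis using assms(4) unfolding interval_discrete_def by simp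
  qed
  obtain h :: "nat \<Rightarrow> real" where h: "strict_mono h" "range h = \<Lambda>"
    using ex_strict_mono_enumeration[OF fin assms(5)] .
  \<comment> \<open>Shifts the zero-based \<open>h\<close> to positive indices; the value
    \<open>l 0 = h 0\<close> from truncated subtraction lies outside \<open>{1..}\<close>.\<close>
  define l where "l n = h (n - 1)" for n
  have "strict_mono_on {1..} l"
    using h(1) by (auto intro!: strict_mono_onI simp: l_def strict_mono_less)
  moreover have "l ` {1..} = \<Lambda>"
  proof -
    have "{1..} = range Suc"
      by (auto simp: image_iff Suc_le_eq gr0_conv_Suc)
    then have "l ` {1..} = l ` range Suc" by simp
    also have "\<dots> = \<Lambda>" using h(2) by (simp add: image_image l_def)
    finally show ?thesis .
  qed
  ultimately have enum: "increasing_enumeration l \<Lambda>"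
    unfolding increasing_enumeration_def by blast
  \<comment> \<open>A single term of a positive series is at most its sum, here the tail after
    \<open>c (Suc n)\<close>. The exponent \<open>Suc n\<close> is relaxed to \<open>n\<close> to
    fit zero-based indexing.\<close>
  have decay: "c (Suc (Suc n)) \<le> c (Suc n) / 2 ^ n" for n
  proof -
    have s: "summable (\<lambda>j. c (Suc n + 1 + j))"
      and lt: "(\<Sum>j. c (Suc n + 1 + j)) < c (Suc n) / 2 ^ Suc n"
      using assms(2)[of "Suc n"] by auto
    have "c (Suc (Suc n)) = (\<Sum>j<1. c (Suc n + 1 + j))" by simp
    also have "\<dots> \<le> (\<Sum>j. c (Suc n + 1 + j))"
      using s assms(1) by (intro sum_le_suminf) (auto intro: less_imp_le)
    also have "\<dots> \<le> c (Suc n) / 2 ^ Suc n" using lt by simp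
    also have "\<dots> \<le> c (Suc n) / 2 ^ n"
      using assms(1)[of "Suc n"] by (intro divide_left_mono) auto
    finally show ?thesis .
  qed
  have "finite {m. h m \<le> y}" for y
  proof (rule finite_imageD)
    show "finite (h ` {m. h m \<le> y})"
      by (rule finite_subset[OF _ fin[of y]]) (use h(2) in auto)
    show "inj_on h {m. h m \<le> y}"
      using h(1) by (rule strict_mono_imp_inj_on)
  qed
  then obtain f :: "real \<Rightarrow> real" where f: "mono f" "\<And>x. 0 \<le> f x"
    "\<And>x. 0 \<le> x \<Longrightarrow> \<not> summable (\<lambda>n. c (Suc n) * f (x + h n))"
    "\<And>x. x < 0 \<Longrightarrow> summable (\<lambda>n. c (Suc n) * f (x + h n))"
    using step_function_c_type_2[of "\<lambda>n. c (Suc n)" h] assms(1) decay h(1) by auto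
  \<comment> \<open>A monotone function is Borel, hence measurable for the completed
    measure.\<close>
  have "f \<in> borel_measurable lebesgue"
    using borel_measurable_mono[OF f(1)] by (simp add: measurable_completion)
  moreover have "\<not> (AE x in lebesgue. summable (\<lambda>n. c (Suc n) * f (x + l (Suc n))))"
    \<comment> \<open>Any nondegenerate interval in \<open>x \<ge> 0\<close> would do here, and any
      in \<open>x < 0\<close> for the next claim.\<close>
    by (rule not_AE_lebesgue_if_fails_on_Icc[of 0 1]) (auto simp: l_def f(3))
  moreover have "\<not> (AE x in lebesgue. \<not> summable (\<lambda>n. c (Suc n) * f (x + l (Suc n))))"
    by (rule not_AE_lebesgue_if_fails_on_Icc[of "-2" "-1"]) (auto simp: l_def f(4))
  ultimately show ?thesis
    unfolding c_type_2_def using enum f(2) by blast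
qed

end
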